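(* Let $V$ be a function holomorphic in an open neighborhood $U$ of $0\in\mathbb{C}$ with $V(0)=0$ and $V'(0)\ne0$, and let $D=d/dx$. Then $$[V(D),x]=V'(D),$$ i.e. $V(D)\,x-x\,V(D)=V'(D)$, where $x$ denotes the operator of multiplication by $x$. The identity holds as operators acting on polynomials in $x$, and on the functions $x^k e^{Ax}$ ($k\ge0$, $A\in U$).
   Context: For $f$ holomorphic on $U$, the operator $f(D)$ acts on the linear span of the functions $x^k e^{Ax}$ ($k\ge 0$, $A\in U$) by $f(D)\,(x^k e^{Ax})=\partial_A^k\bigl(f(A)e^{Ax}\bigr)$. In particular $f(D)e^{Ax}=f(A)e^{Ax}$, and on polynomials (the case $A=0$) $f(D)$ is the finitely acting power series $\sum_j \frac{f^{(j)}(0)}{j!}D^j$. The commutator is $[P,Q]=PQ-QP$, and $V'$ is the derivative of $V$. *)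

theory Defs
  imports "HOL-Complex_Analysis.Complex_Analysis"
begin

definition exp_monom :: "nat \<Rightarrow> complex \<Rightarrow> complex \<Rightarrow> complex" where
  "exp_monom k A = (\<lambda>x. x ^ k * exp (A * x))"

text \<open>
  \<open>fun_of_D U f\<close> is the operator $f(D)$ on the complex linear span of the functions
  $x^k e^{Ax}$ with $A \in U$: it sends $x^k e^{Ax}$ to $\partial_A^k (f(A) e^{Ax})$ and is
  extended linearly. The functions $x^k e^{Ax}$ are linearly independent, so the image of \<open>g\<close>
  does not depend on how \<open>g\<close> is written as a finite linear combination and the definite
  description is uniquely determined; outside the span the value is unspecified.
\<close>

definition fun_of_D ::
    "complex set \<Rightarrow> (complex \<Rightarrow> complex) \<Rightarrow> (complex \<Rightarrow> complex) \<Rightarrow> (complex \<Rightarrow> complex)" where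
  "fun_of_D U f g = (THE h. \<exists>S c. finite S \<and> S \<subseteq> UNIV \<times> U \<and>
      g = (\<lambda>x. \<Sum>(k, A)\<in>S. c k A * exp_monom k A x) \<and>
      h = (\<lambda>x. \<Sum>(k, A)\<in>S. c k A * (deriv ^^ k) (\<lambda>B. f B * exp (B * x)) A))"

definition mult_x :: "(complex \<Rightarrow> complex) \<Rightarrow> (complex \<Rightarrow> complex)" where
  "mult_x g = (\<lambda>x. x * g x)"

definition commutator ::
    "((complex \<Rightarrow> complex) \<Rightarrow> (complex \<Rightarrow> complex)) \<Rightarrow> ((complex \<Rightarrow> complex) \<Rightarrow> (complex \<Rightarrow> complex))
      \<Rightarrow> (complex \<Rightarrow> complex) \<Rightarrow> (complex \<Rightarrow> complex)" where
  "commutator P Q g = (\<lambda>x. P (Q g) x - Q (P g) x)"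

end

theory Submission
  imports Defs
begin

text \<open>
  Differentiating \<open>V(B) e\<^sup>B\<^sup>x\<close> in \<open>B\<close> gives \<open>V'(B) e\<^sup>B\<^sup>x + x V(B) e\<^sup>B\<^sup>x\<close>; taking \<open>k\<close> further
  derivatives yields the identity on \<open>x\<^sup>k e\<^sup>A\<^sup>x\<close>. That \<open>f(D)\<close> is well defined
  rests on the linear independence of these functions: given a vanishing exponential polynomial,
  divide by one exponential \<open>e\<^sup>a\<^sup>x\<close> and differentiate until its polynomial coefficient
  disappears. On the coefficient of \<open>e\<^sup>A\<^sup>x\<close> this iterates the injective map
  \<open>q \<mapsto> q' + (A - a) q\<close>, which allows induction on the number of exponents.
\<close>

text \<open>Since \<open>pderiv\<close> lowers the degree, the coefficient at
  \<open>degree q\<close> comes from \<open>smult b q\<close> alone.\<close>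

lemma pderiv_plus_smult_eq_0:
  fixes q :: "'a::idom poly"
  assumes "b \<noteq> 0" and "pderiv q + smult b q = 0"
  shows "q = 0"
proof (rule ccontr)
  assume "q \<noteq> 0"
  have "coeff (pderiv q + smult b q) (degree q) = b * lead_coeff q"
    by (simp add: coeff_pderiv coeff_eq_0)
  with assms \<open>q \<noteq> 0\<close> show False by simp
qed

lemma funpow_pderiv_plus_smult_eq_0:
  fixes q :: "'a::idom poly"
  assumes "b \<noteq> 0" and "((\<lambda>q. pderiv q + smult b q) ^^ n) q = 0"
  shows "q = 0"
  using assms(2)
proof (induction n)
  case (Suc n)
  show ?case
    by (rule Suc.IH, rule pderiv_plus_smult_eq_0[OF assms(1)]) (use Suc.prems in simp)
qed simp

text \<open>Apply \<open>d/dx - a\<close> to the zero function: this is division by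
  \<open>exp (a * x)\<close>, differentiation and multiplication back, so the exponents stay as they
  are.\<close>

lemma exp_poly_sum_deriv:
  fixes P :: "complex \<Rightarrow> complex poly"
  assumes "\<And>x. (\<Sum>A\<in>F. poly (P A) x * exp (A * x)) = 0"
  shows "(\<Sum>A\<in>F. poly (pderiv (P A) + smult (A - a) (P A)) x * exp (A * x)) = 0"
proof -
  have "((\<lambda>x. \<Sum>A\<in>F. poly (P A) x * exp (A * x)) has_field_derivative
          (\<Sum>A\<in>F. poly (pderiv (P A) + smult A (P A)) x * exp (A * x))) (at x)"
    by (auto intro!: derivative_eq_intros sum.cong simp: algebra_simps)
  moreover have "(\<lambda>x. \<Sum>A\<in>F. poly (P A) x * exp (A * x)) = (\<lambda>x. 0)"
    using assms by auto
  ultimately have "(\<Sum>A\<in>F. poly (pderiv (P A) + smult A (P A)) x * exp (A * x)) = 0"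
    by (auto intro: DERIV_unique)
  moreover have "(\<Sum>A\<in>F. poly (pderiv (P A) + smult (A - a) (P A)) x * exp (A * x)) =
      (\<Sum>A\<in>F. poly (pderiv (P A) + smult A (P A)) x * exp (A * x))
        - a * (\<Sum>A\<in>F. poly (P A) x * exp (A * x))"
    by (simp add: sum_distrib_left ring_distribs mult_ac sum.distrib sum_subtractf)
  ultimately show ?thesis using assms by simp
qed

lemma exp_poly_independent:
  fixes P :: "complex \<Rightarrow> complex poly"
  assumes "finite F" and "\<And>x. (\<Sum>A\<in>F. poly (P A) x * exp (A * x)) = 0" and "A \<in> F"
  shows "P A = 0"
  using assms
proof (induction F arbitrary: P A rule: finite_induct)
  case empty
  then show ?case by simp
next
  case (insert a F)
  \<comment> \<open>\<open>T n A\<close> is the coefficient of \<open>exp (A * x)\<close> after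
    \<open>n\<close> applications of \<open>d/dx - a\<close>.\<close>
  define T where "T n A = ((\<lambda>q. pderiv q + smult (A - a) q) ^^ n) (P A)" for n A
  have T0: "(\<Sum>A\<in>insert a F. poly (T n A) x * exp (A * x)) = 0" for n x
  proof (induction n arbitrary: x)
    case 0
    then show ?case using insert.prems(1) by (simp add: T_def)
  next
    case (Suc n)
    from exp_poly_sum_deriv[OF this, of a] show ?case by (simp add: T_def)
  qed
  \<comment> \<open>At exponent \<open>a\<close> the iterated map is plain \<open>pderiv\<close>, so
    one step more than the degree kills the coefficient.\<close>
  have "T (Suc (degree (P a))) a = 0"
    by (simp add: T_def poly_eq_iff coeff_higher_pderiv coeff_eq_0 del: funpow.simps)
  with T0[of "Suc (degree (P a))"] insert.hyps
  have "(\<Sum>A\<in>F. poly (T (Suc (degree (P a))) A) x * exp (A * x)) = 0" for x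
    by simp
  then have "T (Suc (degree (P a))) B = 0" if "B \<in> F" for B
    using insert.IH that by blast
  then have PF: "P B = 0" if "B \<in> F" for B
    using that insert.hyps funpow_pderiv_plus_smult_eq_0[of "B - a" _ "P B"]
    unfolding T_def by fastforce
  then have "poly (P a) x = 0" for x
    using insert.prems(1)[of x] insert.hyps by simp
  then have "P a = 0" using poly_all_0_iff_0 by blast
  with PF insert.prems(2) show ?case by auto
qed

text \<open>On a rectangle \<open>K \<times> F\<close> the terms can be grouped by exponent; the
  coefficients then become those of one polynomial for each exponent.\<close>

lemma exp_monom_independent:
  assumes "finite K" and "finite F"
    and "\<And>x. (\<Sum>(k, A)\<in>K \<times> F. c k A * exp_monom k A x) = 0"
    and "k \<in> K" and "A \<in> F"
  shows "c k A = 0"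
proof -
  define P where "P B = (\<Sum>j\<in>K. monom (c j B) j)" for B
  have "(\<Sum>B\<in>F. poly (P B) x * exp (B * x)) = (\<Sum>(k, A)\<in>K \<times> F. c k A * exp_monom k A x)" for x
    unfolding P_def exp_monom_def
    by (simp add: poly_sum poly_monom sum_distrib_right mult.assoc
        sum.swap[of _ F K] flip: sum.cartesian_product)
  then have "P A = 0"
    using exp_poly_independent[of F P A] assms by simp
  then have "coeff (P A) k = 0" by simp
  then show ?thesis
    using assms(1,4) by (simp add: P_def coeff_sum)
qed

text \<open>This makes linear extension well defined: \<open>\<phi>\<close> stands for arbitrary
  values prescribed on the basis functions.\<close>

lemma exp_monom_combination_unique:
  fixes c d :: "nat \<Rightarrow> complex \<Rightarrow> complex" and \<phi> :: "nat \<Rightarrow> complex \<Rightarrow> complex"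
  assumes "finite S" and "finite T"
    and eq: "\<And>x. (\<Sum>(k, A)\<in>S. c k A * exp_monom k A x) = (\<Sum>(k, A)\<in>T. d k A * exp_monom k A x)"
  shows "(\<Sum>(k, A)\<in>S. c k A * \<phi> k A) = (\<Sum>(k, A)\<in>T. d k A * \<phi> k A)"
proof -
  define K where "K = fst ` (S \<union> T)"
  define F where "F = snd ` (S \<union> T)"
  \<comment> \<open>Padding with zeros brings both combinations to the common index set
    \<open>K \<times> F\<close>.\<close>
  define c' where "c' k A = (if (k, A) \<in> S then c k A else 0)" for k A
  define d' where "d' k A = (if (k, A) \<in> T then d k A else 0)" for k A
  have fin: "finite K" "finite F" using assms by (auto simp: K_def F_def)
  have sub: "S \<subseteq> K \<times> F" "T \<subseteq> K \<times> F" by (force simp: K_def F_def)+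
  have S: "(\<Sum>(k, A)\<in>S. c k A * \<psi> k A) = (\<Sum>(k, A)\<in>K \<times> F. c' k A * \<psi> k A)"
    for \<psi> :: "nat \<Rightarrow> complex \<Rightarrow> complex"
    using fin sub by (intro sum.mono_neutral_cong_left) (auto simp: c'_def)
  have T: "(\<Sum>(k, A)\<in>T. d k A * \<psi> k A) = (\<Sum>(k, A)\<in>K \<times> F. d' k A * \<psi> k A)"
    for \<psi> :: "nat \<Rightarrow> complex \<Rightarrow> complex"
    using fin sub by (intro sum.mono_neutral_cong_left) (auto simp: d'_def)
  have "(\<Sum>(k, A)\<in>K \<times> F. (c' k A - d' k A) * exp_monom k A x) = 0" for x
    using eq[of x] unfolding S T
    by (simp add: left_diff_distrib case_prod_unfold sum_subtractf)
  then have "c' k A - d' k A = 0" if "k \<in> K" "A \<in> F" for k A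
    using exp_monom_independent[OF fin, of "\<lambda>k A. c' k A - d' k A"] that by blast
  then show ?thesis
    unfolding S T by (intro sum.cong) auto
qed

lemma fun_of_D_combination:
  assumes "finite S" and "S \<subseteq> UNIV \<times> U"
  shows "fun_of_D U f (\<lambda>x. \<Sum>(k, A)\<in>S. c k A * exp_monom k A x) =
    (\<lambda>x. \<Sum>(k, A)\<in>S. c k A * (deriv ^^ k) (\<lambda>B. f B * exp (B * x)) A)"
  unfolding fun_of_D_def
proof (rule the_equality, goal_cases)
  case 1
  show ?case using assms by blast
next
  case (2 h)
  then obtain T d where T: "finite T"
    "(\<lambda>x. \<Sum>(k, A)\<in>S. c k A * exp_monom k A x) = (\<lambda>x. \<Sum>(k, A)\<in>T. d k A * exp_monom k A x)"
    "h = (\<lambda>x. \<Sum>(k, A)\<in>T. d k A * (deriv ^^ k) (\<lambda>B. f B * exp (B * x)) A)"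
    by blast
  show ?case
    unfolding T(3)
    \<comment> \<open>For each fixed \<open>x\<close>, the higher derivative at \<open>A\<close>
      serves as \<open>\<phi> k A\<close>.\<close>
    by (rule ext, rule exp_monom_combination_unique[OF T(1) assms(1)])
      (rule fun_cong[OF T(2), symmetric])
qed

lemma higher_deriv_Suc_mult_exp:
  assumes "open U" and "V holomorphic_on U" and "A \<in> U"
  shows "(deriv ^^ Suc k) (\<lambda>B. V B * exp (B * x)) A =
    (deriv ^^ k) (\<lambda>B. deriv V B * exp (B * x)) A + x * (deriv ^^ k) (\<lambda>B. V B * exp (B * x)) A"
proof -
  have hol: "(\<lambda>B. V B * exp (B * x)) holomorphic_on U"
    "(\<lambda>B. deriv V B * exp (B * x)) holomorphic_on U"
    using assms by (auto intro!: holomorphic_intros)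
  have d: "deriv (\<lambda>B. V B * exp (B * x)) B = deriv V B * exp (B * x) + x * (V B * exp (B * x))"
    if "B \<in> U" for B
    by (rule DERIV_imp_deriv)
      (auto intro!: derivative_eq_intros holomorphic_derivI[OF assms(2,1) that] simp: algebra_simps)
  have "(deriv ^^ Suc k) (\<lambda>B. V B * exp (B * x)) A
      = (deriv ^^ k) (\<lambda>B. deriv V B * exp (B * x) + x * (V B * exp (B * x))) A"
    \<comment> \<open>The innermost derivative is split off, so the product rule is needed only
      once; it holds on the open set \<open>U\<close>, which suffices for the remaining
      \<open>k\<close> derivatives at \<open>A\<close>.\<close>
    unfolding funpow_Suc_right o_def
    using assms hol d
    by (intro higher_deriv_transform_within_open[of _ U]) (auto intro!: holomorphic_intros)
  also have "\<dots> = (deriv ^^ k) (\<lambda>B. deriv V B * exp (B * x)) A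
      + (deriv ^^ k) (\<lambda>B. x * (V B * exp (B * x))) A"
    using hol assms by (intro higher_deriv_add[of _ U]) (auto intro!: holomorphic_intros)
  also have "(deriv ^^ k) (\<lambda>B. x * (V B * exp (B * x))) A
      = x * (deriv ^^ k) (\<lambda>B. V B * exp (B * x)) A"
    using hol assms by (intro higher_deriv_cmult[of _ U]) auto
  finally show ?thesis .
qed

text \<open>Multiplication by \<open>x\<close> raises \<open>k\<close> to \<open>Suc k\<close>, and
  the extra derivative splits into the \<open>deriv V\<close> term and \<open>x\<close> times the
  \<open>V\<close> term.\<close>

lemma commutator_fun_of_D_mult_x_combination:
  assumes "open U" and "V holomorphic_on U" and "finite S" and "S \<subseteq> UNIV \<times> U"
    and g: "g = (\<lambda>x. \<Sum>(k, A)\<in>S. c k A * exp_monom k A x)"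
  shows "commutator (fun_of_D U V) mult_x g = fun_of_D U (deriv V) g"
proof
  fix x
  let ?s = "\<lambda>(k, A). (Suc k, A)"
  have inj: "inj_on ?s S" by (auto simp: inj_on_def)
  \<comment> \<open>Shifted indices are positive, so \<open>k - 1\<close> recovers the original one
    without truncation.\<close>
  have reindex: "(\<Sum>(k, A)\<in>?s ` S. c (k - 1) A * \<psi> k A) = (\<Sum>(k, A)\<in>S. c k A * \<psi> (Suc k) A)"
    for \<psi> :: "nat \<Rightarrow> complex \<Rightarrow> complex"
    by (subst sum.reindex[OF inj]) (simp add: case_prod_unfold)
  have "mult_x g = (\<lambda>x. \<Sum>(k, A)\<in>?s ` S. c (k - 1) A * exp_monom k A x)"
    unfolding reindex
    by (simp add: g mult_x_def exp_monom_def sum_distrib_left case_prod_unfold mult_ac)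
  moreover have "fun_of_D U V (\<lambda>x. \<Sum>(k, A)\<in>?s ` S. c (k - 1) A * exp_monom k A x) x
      = (\<Sum>(k, A)\<in>S. c k A * (deriv ^^ Suc k) (\<lambda>B. V B * exp (B * x)) A)"
    using assms(3,4)
    by (subst fun_of_D_combination[where c = "\<lambda>k. c (k - 1)"]) (auto simp only: reindex finite_imageI)
  ultimately have "fun_of_D U V (mult_x g) x
      = (\<Sum>(k, A)\<in>S. c k A * (deriv ^^ Suc k) (\<lambda>B. V B * exp (B * x)) A)"
    by simp
  also have "\<dots> = (\<Sum>(k, A)\<in>S. c k A * (deriv ^^ k) (\<lambda>B. deriv V B * exp (B * x)) A
      + x * (c k A * (deriv ^^ k) (\<lambda>B. V B * exp (B * x)) A))"
    using assms(4)
    by (intro sum.cong) (auto simp: higher_deriv_Suc_mult_exp[OF assms(1,2)] algebra_simps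
        simp del: funpow.simps)
  also have "\<dots> = fun_of_D U (deriv V) g x + x * fun_of_D U V g x"
    unfolding g fun_of_D_combination[OF assms(3,4)]
    by (simp add: sum.distrib sum_distrib_left case_prod_unfold)
  finally show "commutator (fun_of_D U V) mult_x g x = fun_of_D U (deriv V) g x"
    by (simp add: commutator_def mult_x_def)
qed

theorem proposition2p1:
  fixes V :: "complex \<Rightarrow> complex" and U :: "complex set"
  assumes "open U" and "0 \<in> U" and "V holomorphic_on U"
    and "V 0 = 0" and "deriv V 0 \<noteq> 0"
  shows "(\<forall>p :: complex poly.
            commutator (fun_of_D U V) mult_x (poly p) = fun_of_D U (deriv V) (poly p)) \<and>
         (\<forall>k. \<forall>A\<in>U.
            commutator (fun_of_D U V) mult_x (exp_monom k A) = fun_of_D U (deriv V) (exp_monom k A))"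
proof (intro conjI allI ballI)
  fix p :: "complex poly"
  \<comment> \<open>A polynomial uses only the exponent \<open>0\<close>, which lies in
    \<open>U\<close>.\<close>
  have "poly p = (\<lambda>x. \<Sum>(k, A)\<in>{..degree p} \<times> {0}. coeff p k * exp_monom k A x)"
    by (simp add: fun_eq_iff poly_altdef exp_monom_def flip: sum.cartesian_product)
  then show "commutator (fun_of_D U V) mult_x (poly p) = fun_of_D U (deriv V) (poly p)"
    using assms
    by (intro commutator_fun_of_D_mult_x_combination[where c = "\<lambda>k _. coeff p k"]) auto
next
  fix k A
  assume "A \<in> U"
  then show "commutator (fun_of_D U V) mult_x (exp_monom k A) = fun_of_D U (deriv V) (exp_monom k A)"
    using assms
    by (intro commutator_fun_of_D_mult_x_combination[where S = "{(k, A)}" and c = "\<lambda>_ _. 1"]) auto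
qed

end
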